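(* Let $n,m\ge1$, $P\ge0$ be integers, let $f_0,f_1,\dots,f_P$ be convex real-valued functions with domains $\mathrm{dom}\,f_l\subset\mathbb{H}^n$, and let $\boldsymbol{A}\in\mathbb{H}^{m\times n}$, $\boldsymbol{b}\in\mathbb{H}^m$. Consider the convex quaternion optimization problem $$\min_{\boldsymbol{q}\in\mathbb{H}^n} f_0(\boldsymbol{q})\quad\text{subject to}\quad \boldsymbol{A}\boldsymbol{q}=\boldsymbol{b},\qquad f_l(\boldsymbol{q})\le0,\ l=1,\dots,P .$$ Then any local optimal solution of this problem is also a global optimal solution.
   Context: $\mathbb{H}$ is the algebra of real quaternions, and $\|\boldsymbol{q}\|_2=\sqrt{\boldsymbol{q}^{\mathsf{H}}\boldsymbol{q}}$ on $\mathbb{H}^n$. A function $f:\mathrm{dom}\,f\to\mathbb{R}$ with $\mathrm{dom}\,f\subset\mathbb{H}^n$ is convex if $\mathrm{dom}\,f$ is convex (closed under $\theta\boldsymbol{x}+(1-\theta)\boldsymbol{y}$ for real $0\le\theta\le1$) and $f(\theta\boldsymbol{x}+(1-\theta)\boldsymbol{y})\le\theta f(\boldsymbol{x})+(1-\theta)f(\boldsymbol{y})$ for all $\boldsymbol{x},\boldsymbol{y}\in\mathrm{dom}\,f$, $0\le\theta\le1$. The problem field is $\mathcal{F}=\bigcap_{l=0}^{P}\mathrm{dom}\,f_l$ and the feasible set is $\mathcal{C}=\{\boldsymbol{q}\in\mathcal{F}\mid f_l(\boldsymbol{q})\le0,\ l=1,\dots,P,\ \boldsymbol{A}\boldsymbol{q}=\boldsymbol{b}\}$.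 A local optimal solution is a point $\bar{\boldsymbol{q}}\in\mathcal{C}$ for which there is $\varepsilon>0$ with $f_0(\bar{\boldsymbol{q}})\le f_0(\boldsymbol{q})$ for all $\boldsymbol{q}\in\mathcal{C}$ with $\|\boldsymbol{q}-\bar{\boldsymbol{q}}\|_2<\varepsilon$; a global optimal solution is a point $\bar{\boldsymbol{q}}\in\mathcal{C}$ with $f_0(\bar{\boldsymbol{q}})\le f_0(\boldsymbol{q})$ for all $\boldsymbol{q}\in\mathcal{C}$. *)

theory Defs
  imports "HOL-Analysis.Analysis"
begin

codatatype quat = Quat (QRe: real) (QIm1: real) (QIm2: real) (QIm3: real)

lemma quat_eqI [intro?]:
  "\<lbrakk>QRe x = QRe y; QIm1 x = QIm1 y; QIm2 x = QIm2 y; QIm3 x = QIm3 y\<rbrakk> \<Longrightarrow> x = y"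
  by (rule quat.expand) simp

lemma quat_eq_iff:
  "x = y \<longleftrightarrow> QRe x = QRe y \<and> QIm1 x = QIm1 y \<and> QIm2 x = QIm2 y \<and> QIm3 x = QIm3 y"
  by (auto intro: quat.expand)

instantiation quat :: ab_group_add
begin

primcorec zero_quat where
  "QRe 0 = 0"
| "QIm1 0 = 0"
| "QIm2 0 = 0"
| "QIm3 0 = 0"

primcorec plus_quat where
  "QRe (x + y) = QRe x + QRe y"
| "QIm1 (x + y) = QIm1 x + QIm1 y"
| "QIm2 (x + y) = QIm2 x + QIm2 y"
| "QIm3 (x + y) = QIm3 x + QIm3 y"

primcorec uminus_quat where
  "QRe (- x) = - QRe x"
| "QIm1 (- x) = - QIm1 x"
| "QIm2 (- x) = - QIm2 x"
| "QIm3 (- x) = - QIm3 x"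

primcorec minus_quat where
  "QRe (x - y) = QRe x - QRe y"
| "QIm1 (x - y) = QIm1 x - QIm1 y"
| "QIm2 (x - y) = QIm2 x - QIm2 y"
| "QIm3 (x - y) = QIm3 x - QIm3 y"

instance
  by standard (simp_all add: quat_eq_iff)

end

instantiation quat :: ring_1
begin

primcorec one_quat where
  "QRe 1 = 1"
| "QIm1 1 = 0"
| "QIm2 1 = 0"
| "QIm3 1 = 0"

primcorec times_quat where
  "QRe (x * y) = QRe x * QRe y - QIm1 x * QIm1 y - QIm2 x * QIm2 y - QIm3 x * QIm3 y"
| "QIm1 (x * y) = QRe x * QIm1 y + QIm1 x * QRe y + QIm2 x * QIm3 y - QIm3 x * QIm2 y"
| "QIm2 (x * y) = QRe x * QIm2 y - QIm1 x * QIm3 y + QIm2 x * QRe y + QIm3 x * QIm1 y"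
| "QIm3 (x * y) = QRe x * QIm3 y + QIm1 x * QIm2 y - QIm2 x * QIm1 y + QIm3 x * QRe y"

instance
  by standard (simp_all add: quat_eq_iff algebra_simps)

end

instantiation quat :: real_algebra_1
begin

primcorec scaleR_quat where
  "QRe (scaleR r x) = r * QRe x"
| "QIm1 (scaleR r x) = r * QIm1 x"
| "QIm2 (scaleR r x) = r * QIm2 x"
| "QIm3 (scaleR r x) = r * QIm3 x"

instance
  by standard (simp_all add: quat_eq_iff algebra_simps)

end

instantiation quat :: real_inner
begin

definition inner_quat_def:
  "inner x y = QRe x * QRe y + QIm1 x * QIm1 y + QIm2 x * QIm2 y + QIm3 x * QIm3 y"

definition norm_quat_def:
  "norm (x :: quat) = sqrt ((QRe x)\<^sup>2 + (QIm1 x)\<^sup>2 + (QIm2 x)\<^sup>2 + (QIm3 x)\<^sup>2)"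

definition sgn_quat_def: "sgn (x :: quat) = x /\<^sub>R norm x"

definition dist_quat_def: "dist (x :: quat) y = norm (x - y)"

definition uniformity_quat_def:
  "(uniformity :: (quat \<times> quat) filter) = (INF e\<in>{0 <..}. principal {(x, y). dist x y < e})"

definition open_quat_def:
  "open (U :: quat set) \<longleftrightarrow> (\<forall>x\<in>U. eventually (\<lambda>(x', y). x' = x \<longrightarrow> y \<in> U) uniformity)"

instance
proof
  fix x y z :: quat and r :: real and U :: "quat set"
  show "inner x y = inner y x"
    by (simp add: inner_quat_def mult.commute)
  show "inner (x + y) z = inner x z + inner y z"
    by (simp add: inner_quat_def distrib_right)
  show "inner (scaleR r x) y = r * inner x y"
    by (simp add: inner_quat_def algebra_simps)
  show "0 \<le> inner x x"
    by (simp add: inner_quat_def)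
  show "inner x x = 0 \<longleftrightarrow> x = 0"
    by (simp add: inner_quat_def quat_eq_iff add_nonneg_eq_0_iff)
  show "norm x = sqrt (inner x x)"
    by (simp add: inner_quat_def norm_quat_def power2_eq_square)
  show "sgn x = x /\<^sub>R norm x"
    by (rule sgn_quat_def)
  show "dist x y = norm (x - y)"
    by (rule dist_quat_def)
  show "(uniformity :: (quat \<times> quat) filter) = (INF e\<in>{0 <..}. principal {(x, y). dist x y < e})"
    by (rule uniformity_quat_def)
  show "open U \<longleftrightarrow> (\<forall>x\<in>U. eventually (\<lambda>(x', y). x' = x \<longrightarrow> y \<in> U) uniformity)"
    by (rule open_quat_def)
qed

end

primcorec qcnj :: "quat \<Rightarrow> quat" where
  "QRe (qcnj x) = QRe x"
| "QIm1 (qcnj x) = - QIm1 x"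
| "QIm2 (qcnj x) = - QIm2 x"
| "QIm3 (qcnj x) = - QIm3 x"

text \<open>
  With the norm above, the library norm on \<^typ>\<open>quat ^ 'n\<close> is the norm given by the
  square root of the (real) quaternion obtained by multiplying the conjugate transpose
  of a vector with the vector itself.
\<close>

lemma of_real_quat_sel [simp]:
  "QRe (of_real r) = r" "QIm1 (of_real r) = 0" "QIm2 (of_real r) = 0" "QIm3 (of_real r) = 0"
  by (simp_all add: of_real_def)

lemma qcnj_mult_self: "qcnj x * x = of_real ((norm x)\<^sup>2)"
  by (simp add: quat_eq_iff norm_quat_def power2_eq_square)

lemma norm_quat_vec_squared:
  fixes q :: "quat ^ 'n"
  shows "of_real ((norm q)\<^sup>2) = (\<Sum>i\<in>UNIV. qcnj (q $ i) * q $ i)"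
  by (simp add: qcnj_mult_self norm_vec_def L2_set_def sum_nonneg)

lemma norm_quat_vec_eq:
  fixes q :: "quat ^ 'n"
  shows "norm q = sqrt (QRe (\<Sum>i\<in>UNIV. qcnj (q $ i) * q $ i))"
  by (simp flip: norm_quat_vec_squared del: of_real_power)

text \<open>
  The objective is \<open>f 0\<close>, the inequality constraints are \<open>f 1, \<dots>, f P\<close>, and \<open>D l\<close> is the
  domain of \<open>f l\<close>; values of \<open>f l\<close> outside \<open>D l\<close> play no role.
\<close>

definition problem_field :: "nat \<Rightarrow> (nat \<Rightarrow> (quat ^ 'n) set) \<Rightarrow> (quat ^ 'n) set" where
  "problem_field P D = (\<Inter>l\<in>{0..P}. D l)"

definition feasible_set ::
  "nat \<Rightarrow> (nat \<Rightarrow> (quat ^ 'n) set) \<Rightarrow> (nat \<Rightarrow> quat ^ 'n \<Rightarrow> real) \<Rightarrow>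
    quat ^ 'n ^ 'm \<Rightarrow> quat ^ 'm \<Rightarrow> (quat ^ 'n) set" where
  "feasible_set P D f A b =
    {q \<in> problem_field P D. (\<forall>l\<in>{1..P}. f l q \<le> 0) \<and> A *v q = b}"

definition local_optimal_solution ::
  "nat \<Rightarrow> (nat \<Rightarrow> (quat ^ 'n) set) \<Rightarrow> (nat \<Rightarrow> quat ^ 'n \<Rightarrow> real) \<Rightarrow>
    quat ^ 'n ^ 'm \<Rightarrow> quat ^ 'm \<Rightarrow> quat ^ 'n \<Rightarrow> bool" where
  "local_optimal_solution P D f A b p \<longleftrightarrow>
    p \<in> feasible_set P D f A b \<and>
    (\<exists>\<epsilon>>0. \<forall>q\<in>feasible_set P D f A b. norm (q - p) < \<epsilon> \<longrightarrow> f 0 p \<le> f 0 q)"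

definition global_optimal_solution ::
  "nat \<Rightarrow> (nat \<Rightarrow> (quat ^ 'n) set) \<Rightarrow> (nat \<Rightarrow> quat ^ 'n \<Rightarrow> real) \<Rightarrow>
    quat ^ 'n ^ 'm \<Rightarrow> quat ^ 'm \<Rightarrow> quat ^ 'n \<Rightarrow> bool" where
  "global_optimal_solution P D f A b p \<longleftrightarrow>
    p \<in> feasible_set P D f A b \<and> (\<forall>q\<in>feasible_set P D f A b. f 0 p \<le> f 0 q)"

end

theory Submission
  imports Defs
begin

text \<open>
  A convex function on a convex set has no local minimum that fails to be global: if some
  point \<open>q\<close> had a smaller value than \<open>p\<close>, then by convexity every point of the open segment
  from \<open>p\<close> to \<open>q\<close> would too, and such points lie arbitrarily close to \<open>p\<close>
  (\<open>convex_on_local_min_imp_global_min\<close>). It remains to see that the feasible set is convex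
  (\<open>convex_feasible_set\<close>). It is cut out of the intersection of the convex domains by sublevel
  sets of convex functions and by \<open>A *v q = b\<close>. Noncommutativity of the quaternions does no harm
  in the last constraint, because only real coefficients occur in convex combinations, and reals
  are central.
\<close>

lemma convex_on_local_min_imp_global_min:
  fixes f :: "'a::real_normed_vector \<Rightarrow> real"
  assumes f: "convex_on S f" and "p \<in> S" "q \<in> S" "\<epsilon> > 0"
    and min: "\<And>x. x \<in> S \<Longrightarrow> norm (x - p) < \<epsilon> \<Longrightarrow> f p \<le> f x"
  shows "f p \<le> f q"
proof -
  \<comment> \<open>Adding \<open>\<epsilon>\<close> to the denominator keeps \<open>t\<close> at most 1 and avoids a division by 0 when \<open>q = p\<close>.\<close>
  define t where "t = \<epsilon> / (norm (q - p) + \<epsilon>)"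
  have pos: "norm (q - p) + \<epsilon> > 0"
    using \<open>\<epsilon> > 0\<close> by (simp add: add_nonneg_pos)
  have t: "0 < t" "t \<le> 1"
    using \<open>\<epsilon> > 0\<close> pos by (simp_all add: t_def)
  define x where "x = (1 - t) *\<^sub>R p + t *\<^sub>R q"
  have "x - p = t *\<^sub>R (q - p)"
    by (simp add: x_def algebra_simps)
  then have "norm (x - p) = \<epsilon> * norm (q - p) / (norm (q - p) + \<epsilon>)"
    using \<open>\<epsilon> > 0\<close> pos by (simp add: t_def)
  also have "\<dots> < \<epsilon>"
    using \<open>\<epsilon> > 0\<close> pos by (simp add: divide_less_eq algebra_simps)
  finally have near: "norm (x - p) < \<epsilon>" .
  have "x \<in> S"
    using convexD_alt[OF convex_on_imp_convex[OF f] \<open>p \<in> S\<close> \<open>q \<in> S\<close>, of t] t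
    by (simp add: x_def)
  then have "f p \<le> f x"
    using near by (rule min)
  also have "\<dots> \<le> (1 - t) * f p + t * f q"
    unfolding x_def using convex_onD[OF f, of t p q] t \<open>p \<in> S\<close> \<open>q \<in> S\<close> by simp
  finally have "t * f p \<le> t * f q"
    by (simp add: algebra_simps)
  then show ?thesis
    using t by simp
qed

text \<open>
  The product is only right-linear over the quaternions; real scalars can be moved past the
  entries of the matrix because multiplication in a real algebra is real-bilinear.
\<close>

lemma matrix_vector_mult_scaleR_algebra:
  fixes A :: "'a::real_algebra_1 ^ 'n ^ 'm"
  shows "A *v (r *\<^sub>R x) = r *\<^sub>R (A *v x)"
  by (simp add: vec_eq_iff matrix_vector_mult_def scaleR_sum_right)

lemma convex_affine_solution_set:
  fixes A :: "'a::real_algebra_1 ^ 'n ^ 'm"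
  shows "convex {q. A *v q = b}"
  by (auto simp: convex_def matrix_vector_right_distrib matrix_vector_mult_scaleR_algebra
      simp flip: scaleR_add_left)

lemma convex_sublevel_set:
  assumes f: "convex_on S f"
  shows "convex {x \<in> S. f x \<le> c}"
proof (rule convexI)
  fix x y and u v :: real
  assume xy: "x \<in> {x \<in> S. f x \<le> c}" "y \<in> {x \<in> S. f x \<le> c}"
    and uv: "0 \<le> u" "0 \<le> v" "u + v = 1"
  have "f (u *\<^sub>R x + v *\<^sub>R y) \<le> u * f x + v * f y"
    using f xy uv by (auto simp: convex_on_def)
  also have "\<dots> \<le> c"
    using xy uv by (intro convex_bound_le) auto
  finally show "u *\<^sub>R x + v *\<^sub>R y \<in> {x \<in> S. f x \<le> c}"
    using convexD[OF convex_on_imp_convex[OF f]] xy uv by simp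
qed

lemma convex_feasible_set:
  assumes "\<And>l. l \<le> P \<Longrightarrow> convex_on (D l) (f l)"
  shows "convex (feasible_set P D f A b)"
proof -
  have "feasible_set P D f A b =
      (\<Inter>l\<in>{0..P}. D l) \<inter> (\<Inter>l\<in>{1..P}. {q \<in> D l. f l q \<le> 0}) \<inter> {q. A *v q = b}"
    by (auto simp: feasible_set_def problem_field_def)
  moreover have "convex (D l)" if "l \<le> P" for l
    using assms[OF that] by (rule convex_on_imp_convex)
  ultimately show ?thesis
    using assms by (auto intro!: convex_Int convex_INT convex_affine_solution_set convex_sublevel_set)
qed

theorem theoremV1:
  fixes P :: nat
    and D :: "nat \<Rightarrow> (quat ^ 'n) set"
    and f :: "nat \<Rightarrow> quat ^ 'n \<Rightarrow> real"
    and A :: "quat ^ 'n ^ 'm"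
    and b :: "quat ^ 'm"
    and p :: "quat ^ 'n"
  assumes convex: "\<And>l. l \<le> P \<Longrightarrow> convex_on (D l) (f l)"
    and local: "local_optimal_solution P D f A b p"
  shows "global_optimal_solution P D f A b p"
proof -
  let ?C = "feasible_set P D f A b"
  obtain \<epsilon> where p: "p \<in> ?C" and "\<epsilon> > 0"
    and min: "\<And>x. x \<in> ?C \<Longrightarrow> norm (x - p) < \<epsilon> \<Longrightarrow> f 0 p \<le> f 0 x"
    using local by (auto simp: local_optimal_solution_def)
  have "?C \<subseteq> D 0"
    by (auto simp: feasible_set_def problem_field_def)
  moreover have "convex ?C"
    using convex by (rule convex_feasible_set)
  ultimately have "convex_on ?C (f 0)"
    using convex[of 0] by (auto intro: convex_on_subset)
  then have "f 0 p \<le> f 0 q" if "q \<in> ?C" for q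
    using p that \<open>\<epsilon> > 0\<close> min by (rule convex_on_local_min_imp_global_min)
  with p show ?thesis
    by (simp add: global_optimal_solution_def)
qed

end
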